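(* Let $G$ be a finite simple undirected graph with vertices $v_1,\dots,v_n$, and let $v_i$ and $v_j$ be adjacent vertices of $G$. Then $\mathcal{E}_G(v_i)\,\mathcal{E}_G(v_j)\geq 1$.
   Context: Let $A=A(G)\in M_n(\mathbb{R})$ be the adjacency matrix of $G$ ($A_{ij}=1$ if $v_i$ and $v_j$ are adjacent and $A_{ij}=0$ otherwise). For a matrix $M$, $|M|=(MM^* )^{1/2}$ denotes its absolute value (the positive semidefinite square root of $MM^*$). The energy of the vertex $v_i$ with respect to $G$ is $\mathcal{E}_G(v_i)=|A|_{ii}$, the $i$-th diagonal entry of $|A|$. *)

theory Defs
  imports "HOL-Analysis.Analysis" "Graph_Theory.Pair_Digraph"
begin

text \<open>Simple undirected finite graphs are rendered by the locale \<open>pair_graph\<close>: every edge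
  is represented by its two arcs, and arcs are pairs of vertices, so there are no parallel edges.
  A numbering of the vertices is a bijection \<open>v\<close> from a finite index type onto the vertex set.\<close>

definition adjacency_matrix :: "'a pair_pre_digraph \<Rightarrow> ('n::finite \<Rightarrow> 'a) \<Rightarrow> real^'n^'n"
  where "adjacency_matrix G v = (\<chi> i j. if v i \<rightarrow>\<^bsub>with_proj G\<^esub> v j then 1 else 0)"

text \<open>Over the reals, nonnegativity of the quadratic form does not imply symmetry, so symmetry is
  required separately.\<close>

definition pos_semidef :: "real^'n^'n \<Rightarrow> bool"
  where "pos_semidef B \<longleftrightarrow> transpose B = B \<and> (\<forall>x. 0 \<le> x \<bullet> (B *v x))"

definition matrix_abs :: "real^'m^'n \<Rightarrow> real^'n^'n"
  where "matrix_abs M = (THE B. pos_semidef B \<and> B ** B = M ** transpose M)"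

definition vertex_energy :: "'a pair_pre_digraph \<Rightarrow> ('n::finite \<Rightarrow> 'a) \<Rightarrow> 'n \<Rightarrow> real"
  where "vertex_energy G v i = matrix_abs (adjacency_matrix G v) $ i $ i"

end

theory Submission
  imports Defs
begin

text \<open>The adjacency matrix \<open>A\<close> is symmetric, so it has an orthonormal eigenbasis \<open>E\<close>, with
  eigenvalues \<open>\<mu> e\<close>. Then \<open>A\<close> has the entries
  \<open>A\<^sub>i\<^sub>j = (\<Sum>e\<in>E. \<mu> e * e\<^sub>i * e\<^sub>j)\<close>, and \<open>|A|\<close> is obtained by replacing each \<open>\<mu> e\<close> by \<open>\<bar>\<mu> e\<bar>\<close>.
  Splitting \<open>\<bar>\<mu> e\<bar>\<close> into two square roots, the Cauchy-Schwarz inequality gives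
  \<open>A\<^sub>i\<^sub>j\<^sup>2 \<le> |A|\<^sub>i\<^sub>i * |A|\<^sub>j\<^sub>j\<close> for every symmetric matrix (\<open>entry_squared_le_matrix_abs_diag\<close>),
  and \<open>A\<^sub>i\<^sub>j = 1\<close> when the vertices are adjacent.

  The eigenbasis comes from the variational proof of the spectral theorem: a maximizer of the
  Rayleigh quotient on an invariant subspace is an eigenvector, and an orthonormal set of
  eigenvectors of maximal size leaves no room for a further one in its orthogonal complement.
  The absolute value is defined by a definite description, so the positive semidefinite square
  root of \<open>A A\<^sup>T\<close> must also be shown to be unique; \<open>pos_semidef_root_eigenvector\<close> does this by
  showing that such a root is determined on the eigenbasis.\<close>

section \<open>Orthonormal eigenbases of self-adjoint maps\<close>

text \<open>If \<open>u\<close> maximizes \<open>x \<bullet> f x\<close> on the unit sphere of \<open>S\<close>, with value \<open>\<mu>\<close>, then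
  \<open>Q x = \<mu> * (x \<bullet> x) - x \<bullet> f x\<close> is nonnegative on \<open>S\<close> and vanishes at \<open>u\<close>, so \<open>u\<close>
  minimizes it there. The gradient of \<open>Q\<close> at \<open>u\<close> is twice \<open>\<mu> u - f u\<close>; it lies in \<open>S\<close> because
  \<open>S\<close> is invariant, and it is zero because otherwise \<open>Q\<close> would decrease against it.\<close>

lemma selfadjoint_eigenvector_in_subspace:
  fixes f :: "'a::euclidean_space \<Rightarrow> 'a"
  assumes f: "linear f" and self: "\<And>x y. f x \<bullet> y = x \<bullet> f y"
    and S: "subspace S" and inv: "\<And>x. x \<in> S \<Longrightarrow> f x \<in> S" and nontriv: "\<exists>x\<in>S. x \<noteq> 0"
  obtains u \<mu> where "u \<in> S" "norm u = 1" "f u = \<mu> *\<^sub>R u"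
proof -
  interpret f: linear f by fact
  obtain x0 where x0: "x0 \<in> S" "x0 \<noteq> 0" using nontriv by blast
  have "x0 /\<^sub>R norm x0 \<in> sphere 0 1 \<inter> S"
    using x0 S by (simp add: subspace_scale)
  then have ne: "sphere 0 1 \<inter> S \<noteq> {}" by blast
  have "compact (sphere (0::'a) 1 \<inter> S)"
    by (intro compact_Int_closed closed_subspace S) simp
  moreover have "continuous_on (sphere 0 1 \<inter> S) (\<lambda>x. x \<bullet> f x)"
    by (intro continuous_intros linear_continuous_on linear_conv_bounded_linear[THEN iffD1] f)
  ultimately obtain u where u: "u \<in> sphere 0 1 \<inter> S"
    and umax: "\<forall>x \<in> sphere 0 1 \<inter> S. x \<bullet> f x \<le> u \<bullet> f u"
    using continuous_attains_sup[OF _ ne] by blast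
  define \<mu> where "\<mu> = u \<bullet> f u"
  have uS: "u \<in> S" and nu: "norm u = 1" using u by auto
  have uu: "u \<bullet> u = 1" using nu by (simp add: dot_square_norm)
  have Q: "x \<bullet> f x \<le> \<mu> * (x \<bullet> x)" if "x \<in> S" for x
  proof (cases "x = 0")
    case False
    have "x /\<^sub>R norm x \<in> sphere 0 1 \<inter> S"
      using that False S by (simp add: subspace_scale)
    with umax have "(x /\<^sub>R norm x) \<bullet> f (x /\<^sub>R norm x) \<le> \<mu>"
      unfolding \<mu>_def by blast
    then have "(x \<bullet> f x) / (norm x)\<^sup>2 \<le> \<mu>"
      by (simp add: f.scale power2_eq_square divide_simps)
    then show ?thesis
      using False by (simp add: divide_simps dot_square_norm)
  qed (simp add: f.zero)
  define w where "w = \<mu> *\<^sub>R u - f u"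
  have wS: "w \<in> S"
    unfolding w_def by (intro subspace_diff subspace_scale S uS inv)
  \<comment> \<open>Moving from \<open>u\<close> to \<open>u - t w\<close> changes \<open>Q\<close> by \<open>- 2 t |w|\<^sup>2 + t\<^sup>2 Q w\<close>, which would be
    negative for small positive \<open>t\<close> if \<open>w\<close> were nonzero.\<close>
  define q where "q = \<mu> * (w \<bullet> w) - w \<bullet> f w"
  have quad: "2 * t * (w \<bullet> w) \<le> t\<^sup>2 * q" for t
  proof -
    have "u - t *\<^sub>R w \<in> S" by (intro subspace_diff subspace_scale S uS wS)
    note le = Q[OF this]
    have uw: "u \<bullet> f w = w \<bullet> f u" using self[of u w] by (simp add: inner_commute)
    have e1: "(u - t *\<^sub>R w) \<bullet> f (u - t *\<^sub>R w) = \<mu> - 2 * t * (w \<bullet> f u) + t\<^sup>2 * (w \<bullet> f w)"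
      unfolding f.diff f.scale inner_diff_left inner_diff_right inner_scaleR_left
        inner_scaleR_right uw \<mu>_def[symmetric]
      by (simp add: algebra_simps power2_eq_square)
    have e2: "(u - t *\<^sub>R w) \<bullet> (u - t *\<^sub>R w) = 1 - 2 * t * (u \<bullet> w) + t\<^sup>2 * (w \<bullet> w)"
      using uu by (simp add: inner_diff_left inner_diff_right inner_commute[of w u]
          algebra_simps power2_eq_square)
    have "2 * t * (\<mu> * (u \<bullet> w) - w \<bullet> f u) \<le> t\<^sup>2 * q"
      using le unfolding e1 e2 by (simp add: q_def algebra_simps)
    moreover have "w \<bullet> w = \<mu> * (u \<bullet> w) - w \<bullet> f u"
      by (subst (2) w_def) (simp add: inner_diff_right inner_commute)
    ultimately show ?thesis by simp
  qed
  have "w = 0"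
  proof (rule ccontr)
    assume "w \<noteq> 0"
    then have pos: "w \<bullet> w > 0" by simp
    have "q > 0" using quad[of 1] pos by (simp del: inner_gt_zero_iff)
    \<comment> \<open>The quadratic \<open>- 2 t |w|\<^sup>2 + t\<^sup>2 Q w\<close> is smallest at \<open>t = |w|\<^sup>2 / Q w\<close>.\<close>
    then have "2 * ((w \<bullet> w) * (w \<bullet> w)) \<le> (w \<bullet> w) * (w \<bullet> w)"
      using quad[of "(w \<bullet> w) / q"] by (simp add: field_simps power2_eq_square del: mult_le_cancel_left)
    moreover have "(w \<bullet> w) * (w \<bullet> w) > 0" using pos by (rule mult_pos_pos[OF _ pos])
    ultimately show False by linarith
  qed
  then have "f u = \<mu> *\<^sub>R u" by (simp add: w_def)
  with uS nu show thesis by (rule that)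
qed

lemma selfadjoint_orthonormal_eigenbasis:
  fixes f :: "'a::euclidean_space \<Rightarrow> 'a"
  assumes f: "linear f" and self: "\<And>x y. f x \<bullet> y = x \<bullet> f y"
  obtains E \<mu> where "finite E" "pairwise orthogonal E" "\<And>e. e \<in> E \<Longrightarrow> norm e = 1"
    "span E = UNIV" "\<And>e. e \<in> E \<Longrightarrow> f e = \<mu> e *\<^sub>R e"
proof -
  interpret f: linear f by fact
  define P where "P E \<longleftrightarrow> pairwise orthogonal E \<and> (\<forall>e\<in>E. norm e = 1 \<and> (\<exists>c. f e = c *\<^sub>R e))" for E
  have bound: "finite E \<and> card E \<le> DIM('a)" if "P E" for E
    using that independent_bound[OF pairwise_orthogonal_independent[of E]] unfolding P_def by force
  have "P {}" by (simp add: P_def)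
  moreover have "\<forall>E. P E \<longrightarrow> card E < Suc DIM('a)" using bound by (simp add: less_Suc_eq_le)
  ultimately obtain E where PE: "P E" and Emax: "\<forall>F. P F \<longrightarrow> card F \<le> card E"
    using ex_has_greatest_nat[of P "{}" card] by blast
  have fin: "finite E" using bound PE by blast
  define S where "S = {y. \<forall>x\<in>E. orthogonal x y}"
  have S: "subspace S" unfolding S_def by (rule subspace_orthogonal_to_vectors)
  have inv: "f x \<in> S" if "x \<in> S" for x
    unfolding S_def
  proof (intro CollectI ballI)
    fix e assume e: "e \<in> E"
    then obtain c where "f e = c *\<^sub>R e" using PE unfolding P_def by blast
    then have "e \<bullet> f x = c * (e \<bullet> x)" using self[of e x] by simp
    then show "orthogonal e (f x)" using that e unfolding S_def orthogonal_def by simp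
  qed
  have S0: "x = 0" if "x \<in> S" for x
  proof (rule ccontr)
    assume "x \<noteq> 0"
    with that obtain u c where u: "u \<in> S" "norm u = 1" "f u = c *\<^sub>R u"
      using selfadjoint_eigenvector_in_subspace[OF f self S inv] by blast
    have "u \<notin> E"
    proof
      assume "u \<in> E"
      with u(1) have "orthogonal u u" unfolding S_def by blast
      with u(2) show False by (auto simp: orthogonal_self)
    qed
    moreover have "P (insert u E)"
      using PE u unfolding P_def S_def
      by (auto intro!: pairwise_orthogonal_insert simp: orthogonal_commute)
    ultimately show False using Emax fin by force
  qed
  have "span E = UNIV"
  proof (rule ccontr)
    assume "span E \<noteq> UNIV"
    then obtain a where "a \<noteq> 0" "\<forall>x\<in>span E. a \<bullet> x = 0"
      using span_not_UNIV_orthogonal by blast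
    then show False
      using S0[of a] by (auto simp: S_def orthogonal_def inner_commute span_base)
  qed
  moreover obtain \<mu> where "\<And>e. e \<in> E \<Longrightarrow> f e = \<mu> e *\<^sub>R e"
    using PE unfolding P_def by metis
  ultimately show thesis using that fin PE unfolding P_def by blast
qed

section \<open>Matrices with a given orthonormal eigenbasis\<close>

text \<open>The combination of the rank-one matrices \<open>e e\<^sup>T\<close> with weights \<open>\<mu> e\<close>. For orthonormal \<open>E\<close> it
  has the eigenvalues \<open>\<mu> e\<close>; the entrywise form is the one to which Cauchy-Schwarz applies.\<close>

definition spectral_matrix :: "(real^'n) set \<Rightarrow> (real^'n \<Rightarrow> real) \<Rightarrow> real^'n^'n"
  where "spectral_matrix E \<mu> = (\<chi> i j. \<Sum>e\<in>E. \<mu> e * e $ i * e $ j)"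

lemma spectral_matrix_mult:
  "spectral_matrix E \<mu> *v x = (\<Sum>e\<in>E. (\<mu> e * (e \<bullet> x)) *\<^sub>R e)"
proof (rule vec_eq_iff[THEN iffD2], rule allI)
  fix i
  have "(spectral_matrix E \<mu> *v x) $ i = (\<Sum>j\<in>UNIV. \<Sum>e\<in>E. \<mu> e * e $ i * e $ j * x $ j)"
    by (simp add: spectral_matrix_def matrix_vector_mult_def sum_distrib_right)
  also have "\<dots> = (\<Sum>e\<in>E. \<Sum>j\<in>UNIV. \<mu> e * e $ i * e $ j * x $ j)"
    by (rule sum.swap)
  also have "\<dots> = (\<Sum>e\<in>E. (\<mu> e * (e \<bullet> x)) *\<^sub>R e) $ i"
    by (simp add: inner_vec_def sum_distrib_left sum_distrib_right mult_ac)
  finally show "(spectral_matrix E \<mu> *v x) $ i = (\<Sum>e\<in>E. (\<mu> e * (e \<bullet> x)) *\<^sub>R e) $ i" .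
qed

lemma pos_semidef_spectral_matrix:
  assumes "\<And>e. e \<in> E \<Longrightarrow> 0 \<le> \<mu> e"
  shows "pos_semidef (spectral_matrix E \<mu>)"
proof -
  have "transpose (spectral_matrix E \<mu>) = spectral_matrix E \<mu>"
    by (simp add: transpose_def spectral_matrix_def vec_eq_iff mult_ac)
  moreover have "x \<bullet> (spectral_matrix E \<mu> *v x) = (\<Sum>e\<in>E. \<mu> e * (e \<bullet> x)\<^sup>2)" for x
    by (simp add: spectral_matrix_mult inner_sum_right inner_commute power2_eq_square mult_ac)
  ultimately show ?thesis
    using assms by (simp add: pos_semidef_def sum_nonneg)
qed

lemma spectral_matrix_eigenvector:
  assumes "finite E" "pairwise orthogonal E" "\<And>e. e \<in> E \<Longrightarrow> norm e = 1" "u \<in> E"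
  shows "spectral_matrix E \<mu> *v u = \<mu> u *\<^sub>R u"
proof -
  have "(\<mu> e * (e \<bullet> u)) *\<^sub>R e = (if e = u then \<mu> u *\<^sub>R u else 0)" if "e \<in> E" for e
    using assms that by (auto simp: pairwise_def orthogonal_def dot_square_norm)
  then have "spectral_matrix E \<mu> *v u = (\<Sum>e\<in>E. if e = u then \<mu> u *\<^sub>R u else 0)"
    unfolding spectral_matrix_mult by (intro sum.cong refl)
  then show ?thesis using assms(1,4) by simp
qed

lemma eq_spectral_matrixI:
  assumes E: "finite E" "pairwise orthogonal E" "\<And>e. e \<in> E \<Longrightarrow> norm e = 1" "span E = UNIV"
    and eig: "\<And>e. e \<in> E \<Longrightarrow> M *v e = \<mu> e *\<^sub>R e"
  shows "M = spectral_matrix E \<mu>"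
  unfolding matrix_eq
proof
  fix x
  show "M *v x = spectral_matrix E \<mu> *v x"
    by (rule linear_eq_on_span[of "(*v) M" "(*v) (spectral_matrix E \<mu>)" E])
      (simp_all add: eig E spectral_matrix_eigenvector)
qed

section \<open>The absolute value of a symmetric matrix\<close>

text \<open>Write \<open>w = B u - c u\<close>. If \<open>c > 0\<close>, then \<open>(B + c) w = (B\<^sup>2 - c\<^sup>2) u = 0\<close>, and since
  \<open>w \<bullet> B w \<ge> 0\<close>, pairing with \<open>w\<close> forces \<open>w = 0\<close>. If \<open>c = 0\<close>, then \<open>|B u|\<^sup>2 = u \<bullet> B\<^sup>2 u = 0\<close>.\<close>

lemma pos_semidef_root_eigenvector:
  assumes B: "pos_semidef B" and c: "0 \<le> c" and eig: "(B ** B) *v u = c\<^sup>2 *\<^sub>R u"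
  shows "B *v u = c *\<^sub>R u"
proof (cases "c = 0")
  case True
  have "(B *v u) \<bullet> (B *v u) = u \<bullet> ((B ** B) *v u)"
    using B by (metis dot_lmul_matrix matrix_vector_mul_assoc pos_semidef_def transpose_matrix_vector)
  also have "\<dots> = 0" using eig True by simp
  finally show ?thesis using True by simp
next
  case False
  define w where "w = B *v u - c *\<^sub>R u"
  have "B *v w = - (c *\<^sub>R w)"
    using eig unfolding w_def
    by (simp add: matrix_vector_mult_diff_distrib matrix_vector_mul_assoc matrix_vector_mult_scaleR
        scaleR_diff_right power2_eq_square)
  then have "0 \<le> - (c * (w \<bullet> w))"
    using B unfolding pos_semidef_def by (metis inner_minus_right inner_scaleR_right)
  moreover have "c > 0" using c False by simp
  ultimately have "w \<bullet> w \<le> 0" by (simp add: mult_le_0_iff)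
  then have "w = 0" by (metis inner_ge_zero inner_eq_zero_iff order_antisym)
  then show ?thesis by (simp add: w_def)
qed

lemma matrix_abs_eq_spectral_matrix:
  fixes A :: "real^'n^'n"
  assumes sym: "transpose A = A"
    and E: "finite E" "pairwise orthogonal E" "\<And>e. e \<in> E \<Longrightarrow> norm e = 1" "span E = UNIV"
    and eig: "\<And>e. e \<in> E \<Longrightarrow> A *v e = \<mu> e *\<^sub>R e"
  shows "matrix_abs A = spectral_matrix E (\<lambda>e. \<bar>\<mu> e\<bar>)"
  unfolding matrix_abs_def sym
proof (rule the_equality)
  let ?C = "spectral_matrix E (\<lambda>e. \<bar>\<mu> e\<bar>)"
  have A2: "(A ** A) *v e = \<bar>\<mu> e\<bar>\<^sup>2 *\<^sub>R e" if "e \<in> E" for e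
    using eig[OF that]
    by (simp add: matrix_vector_mul_assoc[symmetric] matrix_vector_mult_scaleR power2_eq_square)
  have C2: "(?C ** ?C) *v e = \<bar>\<mu> e\<bar>\<^sup>2 *\<^sub>R e" if "e \<in> E" for e
    using spectral_matrix_eigenvector[OF E(1-3) that, of "\<lambda>e. \<bar>\<mu> e\<bar>"]
    by (simp add: matrix_vector_mul_assoc[symmetric] matrix_vector_mult_scaleR power2_eq_square)
  have "?C ** ?C = A ** A"
    using eq_spectral_matrixI[OF E C2] eq_spectral_matrixI[OF E A2] by simp
  then show "pos_semidef ?C \<and> ?C ** ?C = A ** A"
    by (simp add: pos_semidef_spectral_matrix)
  fix B assume B: "pos_semidef B \<and> B ** B = A ** A"
  show "B = ?C"
  proof (rule eq_spectral_matrixI[OF E])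
    fix e assume "e \<in> E"
    then show "B *v e = \<bar>\<mu> e\<bar> *\<^sub>R e"
      using pos_semidef_root_eigenvector[of B "\<bar>\<mu> e\<bar>" e] B A2 by simp
  qed
qed

theorem entry_squared_le_matrix_abs_diag:
  fixes A :: "real^'n^'n"
  assumes sym: "transpose A = A"
  shows "(A $ i $ j)\<^sup>2 \<le> matrix_abs A $ i $ i * matrix_abs A $ j $ j"
proof -
  have "(A *v x) \<bullet> y = x \<bullet> (A *v y)" for x y
    using sym by (metis dot_lmul_matrix transpose_matrix_vector)
  then obtain E \<mu> where E: "finite E" "pairwise orthogonal E" "\<And>e. e \<in> E \<Longrightarrow> norm e = 1"
      "span E = UNIV" and eig: "\<And>e. e \<in> E \<Longrightarrow> A *v e = \<mu> e *\<^sub>R e"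
    using selfadjoint_orthonormal_eigenbasis[OF matrix_vector_mul_linear] by blast
  have abs: "matrix_abs A = spectral_matrix E (\<lambda>e. \<bar>\<mu> e\<bar>)"
    by (rule matrix_abs_eq_spectral_matrix[OF sym E eig])
  \<comment> \<open>The sign of \<open>\<mu> e\<close> goes into one of the two factors.\<close>
  let ?a = "\<lambda>e. sgn (\<mu> e) * sqrt \<bar>\<mu> e\<bar> * e $ i" and ?b = "\<lambda>e. sqrt \<bar>\<mu> e\<bar> * e $ j"
  have ab: "?a e * ?b e = \<mu> e * e $ i * e $ j" for e
  proof -
    have "?a e * ?b e = sgn (\<mu> e) * (sqrt \<bar>\<mu> e\<bar> * sqrt \<bar>\<mu> e\<bar>) * e $ i * e $ j"
      by (simp only: mult_ac)
    then show ?thesis by (simp add: sgn_mult_abs)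
  qed
  have a2: "(?a e)\<^sup>2 = \<bar>\<mu> e\<bar> * e $ i * e $ i" and b2: "(?b e)\<^sup>2 = \<bar>\<mu> e\<bar> * e $ j * e $ j" for e
    by (cases "\<mu> e = 0"; simp add: power_mult_distrib power2_eq_square sgn_if)+
  have "A $ i $ j = (\<Sum>e\<in>E. ?a e * ?b e)"
    unfolding ab by (subst eq_spectral_matrixI[OF E eig]) (simp_all add: spectral_matrix_def)
  moreover have "matrix_abs A $ i $ i = (\<Sum>e\<in>E. (?a e)\<^sup>2)"
    and "matrix_abs A $ j $ j = (\<Sum>e\<in>E. (?b e)\<^sup>2)"
    unfolding a2 b2 abs by (simp_all add: spectral_matrix_def)
  ultimately show ?thesis
    using Cauchy_Schwarz_ineq_sum[of ?a ?b E] by simp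
qed

section \<open>Energies of adjacent vertices\<close>

theorem theorem3:
  fixes G :: "'a pair_pre_digraph" and v :: "'n::finite \<Rightarrow> 'a" and i j :: 'n
  assumes "pair_graph G"
    and "bij_betw v UNIV (pverts G)"
    and "v i \<rightarrow>\<^bsub>with_proj G\<^esub> v j"
  shows "vertex_energy G v i * vertex_energy G v j \<ge> 1"
proof -
  interpret pair_graph G by fact
  have "transpose (adjacency_matrix G v) = adjacency_matrix G v"
    using arcs_ends_symmetric[OF sym_arcs]
    by (auto simp: transpose_def adjacency_matrix_def vec_eq_iff)
  from entry_squared_le_matrix_abs_diag[OF this, of i j] show ?thesis
    using assms(3) by (simp add: vertex_energy_def adjacency_matrix_def)
qed

end
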